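(* Let $E=\mathbb N=\{0,1,2,\dots\}$ or $E=\{0,1,\dots,N\}$ for some integer $N\ge 1$, and let $u,v:E\to[0,\infty)$ satisfy: (i) $u(0)=0$, $u(1)=1$ and $u(n)>0$ for all $n>0$; (ii) $v(0)\neq 0$, $v(N)=0$ if $E=\{0,\dots,N\}$, and $v(n)>0$ in all other cases. Let $x\neq y$ be two sites and consider the Markov process with single-edge generator $$L_{x,y}f(\eta)=u(\eta_x)v(\eta_y)\,(f(\eta^{x,y})-f(\eta))+u(\eta_y)v(\eta_x)\,(f(\eta^{y,x})-f(\eta)).$$ Assume that this process is self-dual with a factorized self-duality function $D(\xi,\eta)=\prod_{x} d(\xi_x,\eta_x)$, where $d:E\times E\to\mathbb R$ satisfies $d(0,\cdot)\equiv 1$. If $d(1,n)$ is not constant as a function of $n$, then for all $n\in E$ $$u(n)=n,\qquad v(n)=v(0)+(v(1)-v(0))\,n,$$ and there exist $a\in\mathbb R$ and $b\neq 0$ such that $$d(1,n)=a+bn\qquad\text{for all } n\in E.$$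
   Context: Configurations $\eta$ assign to each site $x$ a number of particles $\eta_x\in E$. The configuration $\eta^{x,y}$ is obtained from $\eta$ by removing one particle at $x$ and adding one at $y$: $\eta^{x,y}_x=\eta_x-1$, $\eta^{x,y}_y=\eta_y+1$, and $\eta^{x,y}_z=\eta_z$ for $z\ne x,y$ (terms with zero rate are understood to vanish). A process is self-dual with self-duality function $D$ if for all $t>0$ and all configurations $\xi,\eta$ one has $\mathbb E_\xi D(\xi(t),\eta)=\mathbb E_\eta D(\xi,\eta(t))$, where both $\{\xi(t)\}$ and $\{\eta(t)\}$ evolve according to the process. At generator level this means that the generator applied to $D(\cdot,\eta)$ and evaluated at $\xi$ equals the generator applied to $D(\xi,\cdot)$ and evaluated at $\eta$. *)

theory Defs
  imports "HOL-Probability.Probability"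
begin

type_synonym 's config = "'s \<Rightarrow> nat"

definition configs :: "nat set \<Rightarrow> 's config set" where
  "configs E = {\<eta>. \<forall>z. \<eta> z \<in> E}"

text \<open>Natural-number subtraction truncates at an empty site, and the target may leave the
  configuration space at a full site; in the generator both cases are multiplied by the rate zero.\<close>

definition move :: "'s \<Rightarrow> 's \<Rightarrow> 's config \<Rightarrow> 's config" where
  "move x y \<eta> = \<eta>(x := \<eta> x - 1, y := \<eta> y + 1)"

definition edge_generator ::
  "(nat \<Rightarrow> real) \<Rightarrow> (nat \<Rightarrow> real) \<Rightarrow> 's \<Rightarrow> 's \<Rightarrow> ('s config \<Rightarrow> real) \<Rightarrow> 's config \<Rightarrow> real" where
  "edge_generator u v x y f \<eta> =
     u (\<eta> x) * v (\<eta> y) * (f (move x y \<eta>) - f \<eta>) +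
     u (\<eta> y) * v (\<eta> x) * (f (move y x \<eta>) - f \<eta>)"

text \<open>A Markov process on the state space \<open>S\<close> is given by its transition function:
  \<open>P t \<eta>\<close> is the law at time \<open>t\<close> of the process started from \<open>\<eta>\<close>.
  Values at negative times or outside \<open>S\<close> are irrelevant.\<close>

definition markov_transition_function :: "'a set \<Rightarrow> (real \<Rightarrow> 'a \<Rightarrow> 'a pmf) \<Rightarrow> bool" where
  "markov_transition_function S P \<longleftrightarrow>
     (\<forall>t\<ge>0. \<forall>\<eta>\<in>S. set_pmf (P t \<eta>) \<subseteq> S) \<and>
     (\<forall>\<eta>\<in>S. P 0 \<eta> = return_pmf \<eta>) \<and>
     (\<forall>s\<ge>0. \<forall>t\<ge>0. \<forall>\<eta>\<in>S. P (s + t) \<eta> = bind_pmf (P s \<eta>) (P t))"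

text \<open>The generator as the pointwise derivative of the semigroup at time zero on bounded
  functions. Since rates may be unbounded over \<open>S\<close>, uniform convergence is not required.\<close>

definition has_generator ::
  "'a set \<Rightarrow> (real \<Rightarrow> 'a \<Rightarrow> 'a pmf) \<Rightarrow> (('a \<Rightarrow> real) \<Rightarrow> 'a \<Rightarrow> real) \<Rightarrow> bool" where
  "has_generator S P L \<longleftrightarrow>
     (\<forall>f. bounded (f ` S) \<longrightarrow> (\<forall>\<eta>\<in>S.
        ((\<lambda>t. (measure_pmf.expectation (P t \<eta>) f - f \<eta>) / t) \<longlongrightarrow> L f \<eta>) (at_right 0)))"

text \<open>For the single-edge dynamics particle number is conserved, so every law \<open>P t \<eta>\<close> has finite
  support and the expectations below are finite sums, also when \<open>D\<close> is unbounded.\<close>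

definition self_dual ::
  "'a set \<Rightarrow> (real \<Rightarrow> 'a \<Rightarrow> 'a pmf) \<Rightarrow> ('a \<Rightarrow> 'a \<Rightarrow> real) \<Rightarrow> bool" where
  "self_dual S P D \<longleftrightarrow>
     (\<forall>t>0. \<forall>\<xi>\<in>S. \<forall>\<eta>\<in>S.
        measure_pmf.expectation (P t \<xi>) (\<lambda>\<xi>'. D \<xi>' \<eta>) =
        measure_pmf.expectation (P t \<eta>) (\<lambda>\<eta>'. D \<xi> \<eta>'))"

definition factorized :: "(nat \<Rightarrow> nat \<Rightarrow> real) \<Rightarrow> 's::finite config \<Rightarrow> 's config \<Rightarrow> real" where
  "factorized d \<xi> \<eta> = (\<Prod>z\<in>UNIV. d (\<xi> z) (\<eta> z))"

end

theory Submission imports Defs begin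

text \<open>Particle number is conserved: the probability of leaving a finite class \<open>C\<close> on which the
  generator annihilates the indicator of \<open>C\<close> is \<open>o(h)\<close> over a time step \<open>h\<close>, uniformly on
  \<open>C\<close>; cutting \<open>[0, t]\<close> into \<open>n\<close> equal steps shows that it vanishes for every \<open>t\<close>. On such a
  class every function is bounded, so duality of the semigroup may be differentiated at time zero.
  Dualising with a single particle at \<open>x\<close> gives, for \<open>g = d 1\<close>,
  \<open>v 0 (g m - g n) = u n v m (g (n - 1) - g n) + u m v n (g (n + 1) - g n)\<close>.
  Here \<open>n = 0\<close> yields \<open>g m = g 0 + b u m\<close>, then \<open>m = 0\<close> yields \<open>u n = n\<close>,
  and finally \<open>n = 1\<close> yields \<open>v\<close>.\<close>

section \<open>Confinement of a Markov process to a finite class\<close>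

lemma prob_bind_pmf:
  "measure_pmf.prob (bind_pmf M f) A = measure_pmf.expectation M (\<lambda>x. measure_pmf.prob (f x) A)"
  unfolding measure_pmf_bind
  by (rule measure_pmf.measure_bind[where N = "count_space UNIV"])
    (auto simp: space_subprob_algebra subprob_space_measure_pmf)

text \<open>Split by the Markov property after the first step: a path already outside
  \<open>C\<close> contributes at most 1, one still in \<open>C\<close> at most
  \<open>real n * c\<close> by induction. Hence the one-step errors add up.\<close>

lemma escape_probability_le:
  fixes P :: "real \<Rightarrow> 'a \<Rightarrow> 'a pmf"
  assumes P: "markov_transition_function S P" and "C \<subseteq> S" and "h \<ge> 0" and "c \<ge> 0"
    and step: "\<And>\<zeta>. \<zeta> \<in> C \<Longrightarrow> measure_pmf.prob (P h \<zeta>) (- C) \<le> c"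
    and "\<eta> \<in> C"
  shows "measure_pmf.prob (P (real n * h) \<eta>) (- C) \<le> real n * c"
  using \<open>\<eta> \<in> C\<close>
proof (induction n arbitrary: \<eta>)
  case 0
  then show ?case
    using P \<open>C \<subseteq> S\<close> by (auto simp: markov_transition_function_def subset_iff)
next
  case (Suc n)
  have "real n * h \<ge> 0"
    using \<open>h \<ge> 0\<close> by simp
  moreover have "\<eta> \<in> S"
    using Suc.prems \<open>C \<subseteq> S\<close> by blast
  ultimately have "P (h + real n * h) \<eta> = bind_pmf (P h \<eta>) (P (real n * h))"
    using P \<open>h \<ge> 0\<close> unfolding markov_transition_function_def by blast
  moreover have "h + real n * h = real (Suc n) * h"
    by (simp add: algebra_simps)
  ultimately have "measure_pmf.prob (P (real (Suc n) * h) \<eta>) (- C) =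
      measure_pmf.expectation (P h \<eta>) (\<lambda>\<zeta>. measure_pmf.prob (P (real n * h) \<zeta>) (- C))"
    by (simp only: prob_bind_pmf)
  also have "\<dots> \<le> measure_pmf.expectation (P h \<eta>) (\<lambda>\<zeta>. indicator (- C) \<zeta> + real n * c)"
  proof (rule integral_mono)
    show "integrable (P h \<eta>) (\<lambda>\<zeta>. measure_pmf.prob (P (real n * h) \<zeta>) (- C))"
      by (rule measure_pmf.integrable_const_bound[where B = 1]) auto
    show "integrable (P h \<eta>) (\<lambda>\<zeta>. indicator (- C) \<zeta> + real n * c)"
      by (rule measure_pmf.integrable_const_bound[where B = "1 + real n * c"])
        (use \<open>c \<ge> 0\<close> in \<open>auto simp: indicator_def\<close>)
    show "measure_pmf.prob (P (real n * h) \<zeta>) (- C) \<le> indicator (- C) \<zeta> + real n * c" for \<zeta>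
    proof (cases "\<zeta> \<in> C")
      case False
      moreover have "measure_pmf.prob (P (real n * h) \<zeta>) (- C) \<le> 1"
        by simp
      ultimately show ?thesis
        using \<open>c \<ge> 0\<close> by (simp add: add_increasing2)
    qed (use Suc.IH in simp)
  qed
  also have "\<dots> = measure_pmf.prob (P h \<eta>) (- C) + real n * c"
    by (subst Bochner_Integration.integral_add) (auto simp: measure_pmf.emeasure_eq_measure)
  also have "\<dots> \<le> real (Suc n) * c"
    using step[OF Suc.prems] by (simp add: algebra_simps)
  finally show ?case .
qed

lemma set_pmf_subset_invariant_class:
  fixes P :: "real \<Rightarrow> 'a \<Rightarrow> 'a pmf"
  assumes P: "markov_transition_function S P" and gen: "has_generator S P L"
    and "finite C" and "C \<subseteq> S" and inv: "\<And>\<zeta>. \<zeta> \<in> C \<Longrightarrow> L (indicator C) \<zeta> = 0"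
    and "\<eta> \<in> C" and "t > 0"
  shows "set_pmf (P t \<eta>) \<subseteq> C"
proof -
  have "measure_pmf.prob (P t \<eta>) (- C) \<le> e" if "e > 0" for e
  proof -
    \<comment> \<open>Chosen so that \<open>n\<close> steps of length \<open>t / n\<close>, each
      with escape bound \<open>e' * (t / n)\<close>, accumulate exactly \<open>e\<close>.\<close>
    define e' where "e' = e / t"
    have "e' > 0"
      using that \<open>t > 0\<close> by (simp add: e'_def)
    have "\<forall>\<^sub>F h in at_right 0. measure_pmf.prob (P h \<zeta>) (- C) \<le> e' * h" if "\<zeta> \<in> C" for \<zeta>
    proof -
      have "bounded (indicator C ` S :: real set)"
        by (rule finite_imp_bounded, rule finite_subset[of _ "{0, 1}"]) (auto simp: indicator_def)
      then have "((\<lambda>h. (measure_pmf.expectation (P h \<zeta>) (indicator C) - indicator C \<zeta>) / h)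
          \<longlongrightarrow> L (indicator C) \<zeta>) (at_right 0)"
        using gen that \<open>C \<subseteq> S\<close> unfolding has_generator_def by blast
      then have "((\<lambda>h. (measure_pmf.prob (P h \<zeta>) C - 1) / h) \<longlongrightarrow> 0) (at_right 0)"
        using that inv by simp
      then have "\<forall>\<^sub>F h in at_right 0. (measure_pmf.prob (P h \<zeta>) C - 1) / h > - e'"
        using \<open>e' > 0\<close> by (auto dest: order_tendstoD(1)[where a = "- e'"])
      with eventually_at_right_less[of "0::real"] show ?thesis
      proof eventually_elim
        case (elim h)
        then have "measure_pmf.prob (P h \<zeta>) C - 1 > - e' * h"
          by (simp add: field_simps)
        then show ?case
          using measure_pmf.prob_compl[of C "P h \<zeta>"] by (simp add: Compl_eq_Diff_UNIV)
      qed
    qed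
    \<comment> \<open>Finiteness of \<open>C\<close> gives one threshold \<open>r\<close> for all
      starting points in \<open>C\<close>, as the iteration of equal steps requires.\<close>
    then have "\<forall>\<^sub>F h in at_right 0. \<forall>\<zeta>\<in>C. measure_pmf.prob (P h \<zeta>) (- C) \<le> e' * h"
      using \<open>finite C\<close> by (simp add: eventually_ball_finite)
    then obtain r where r: "r > 0"
      "\<And>h \<zeta>. 0 < h \<Longrightarrow> h < r \<Longrightarrow> \<zeta> \<in> C \<Longrightarrow> measure_pmf.prob (P h \<zeta>) (- C) \<le> e' * h"
      unfolding eventually_at_right_field by blast
    obtain n where n: "real n > t / r"
      using reals_Archimedean2 by blast
    moreover have "t / r > 0"
      using \<open>t > 0\<close> \<open>r > 0\<close> by simp
    ultimately have "real n > 0"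
      by linarith
    define h where "h = t / real n"
    have h: "h > 0" "h < r" "real n * h = t"
      using n \<open>real n > 0\<close> \<open>t > 0\<close> \<open>r > 0\<close> by (auto simp: h_def field_simps)
    have "measure_pmf.prob (P (real n * h) \<eta>) (- C) \<le> real n * (e' * h)"
      using h r \<open>e' > 0\<close> by (intro escape_probability_le[OF P \<open>C \<subseteq> S\<close>] \<open>\<eta> \<in> C\<close>) auto
    also have "\<dots> = e' * (real n * h)"
      by simp
    also have "\<dots> = e"
      using \<open>t > 0\<close> unfolding h(3) e'_def by simp
    finally show ?thesis
      by (simp add: h(3))
  qed
  then have "measure_pmf.prob (P t \<eta>) (- C) \<le> 0"
    by (rule field_le_epsilon) simp
  then have "measure_pmf.prob (P t \<eta>) (- C) = 0"
    by (simp add: measure_le_0_iff)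
  then show ?thesis
    by (auto simp: measure_pmf_zero_iff)
qed

text \<open>\<open>has_generator\<close> covers only functions bounded on \<open>S\<close>. Cutting
  \<open>f\<close> off outside the finite \<open>C\<close> makes it bounded and leaves its
  expectations unchanged, because the laws started in \<open>C\<close> are supported in
  \<open>C\<close>.\<close>

lemma generator_limit_on_invariant_class:
  fixes P :: "real \<Rightarrow> 'a \<Rightarrow> 'a pmf"
  assumes P: "markov_transition_function S P" and gen: "has_generator S P L"
    and "finite C" and "C \<subseteq> S" and inv: "\<And>\<zeta>. \<zeta> \<in> C \<Longrightarrow> L (indicator C) \<zeta> = 0"
    and "\<eta> \<in> C"
  shows "((\<lambda>t. (measure_pmf.expectation (P t \<eta>) f - f \<eta>) / t)
    \<longlongrightarrow> L (\<lambda>\<zeta>. indicator C \<zeta> * f \<zeta>) \<eta>) (at_right 0)"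
proof -
  let ?g = "\<lambda>\<zeta>. indicator C \<zeta> * f \<zeta>"
  have "bounded (?g ` S)"
    by (rule finite_imp_bounded, rule finite_subset[of _ "insert 0 (f ` C)"])
      (use \<open>finite C\<close> in \<open>auto simp: indicator_def\<close>)
  then have lim: "((\<lambda>t. (measure_pmf.expectation (P t \<eta>) ?g - ?g \<eta>) / t) \<longlongrightarrow> L ?g \<eta>) (at_right 0)"
    using gen \<open>\<eta> \<in> C\<close> \<open>C \<subseteq> S\<close> unfolding has_generator_def by blast
  have "\<forall>\<^sub>F t in at_right (0::real). (measure_pmf.expectation (P t \<eta>) ?g - ?g \<eta>) / t =
      (measure_pmf.expectation (P t \<eta>) f - f \<eta>) / t"
    using eventually_at_right_less[of "0::real"]
  proof eventually_elim
    case (elim t)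
    have "set_pmf (P t \<eta>) \<subseteq> C"
      by (rule set_pmf_subset_invariant_class[OF assms \<open>0 < t\<close>])
    then have "measure_pmf.expectation (P t \<eta>) ?g = measure_pmf.expectation (P t \<eta>) f"
      by (intro integral_cong_AE) (auto simp: AE_measure_pmf_iff)
    then show ?case
      using \<open>\<eta> \<in> C\<close> by simp
  qed
  with lim show ?thesis
    by (rule Lim_transform_eventually)
qed

section \<open>Particle conservation and duality of the edge generator\<close>

lemma sum_move:
  fixes x y :: "'s::finite"
  assumes "x \<noteq> y" and "\<eta> x > 0"
  shows "sum (move x y \<eta>) UNIV = sum \<eta> UNIV"
proof -
  have split: "sum f UNIV = f x + (f y + sum f (UNIV - {x} - {y}))" for f :: "'s \<Rightarrow> nat"
    using \<open>x \<noteq> y\<close> by (simp add: sum.remove[of _ x] sum.remove[of _ y])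
  have "sum (move x y \<eta>) (UNIV - {x} - {y}) = sum \<eta> (UNIV - {x} - {y})"
    by (intro sum.cong) (auto simp: move_def)
  then show ?thesis
    using assms by (simp add: split move_def)
qed

text \<open>\<open>E_pred\<close> and \<open>E_succ\<close> treat both shapes of \<open>E\<close> at
  once: adding a particle can leave \<open>E\<close> only where \<open>v\<close> vanishes.\<close>

locale edge_dynamics =
  fixes E :: "nat set" and u v :: "nat \<Rightarrow> real" and x y :: "'s::finite"
    and P :: "real \<Rightarrow> 's config \<Rightarrow> 's config pmf"
  assumes E_pred: "Suc n \<in> E \<Longrightarrow> n \<in> E"
    and E_succ: "n \<in> E \<Longrightarrow> v n \<noteq> 0 \<Longrightarrow> Suc n \<in> E"
    and u_0: "u 0 = 0"
    and sites: "x \<noteq> y"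
    and transition: "markov_transition_function (configs E) P"
    and generator: "has_generator (configs E) P (edge_generator u v x y)"
begin

text \<open>Fixing the total over all sites bounds every occupation number, so the class is finite
  even for infinite \<open>E\<close>.\<close>

definition particle_class :: "'s config \<Rightarrow> 's config set" where
  "particle_class \<eta> = {\<zeta> \<in> configs E. sum \<zeta> UNIV = sum \<eta> UNIV}"

lemma finite_particle_class: "finite (particle_class \<eta>)"
proof (rule finite_subset)
  show "particle_class \<eta> \<subseteq> PiE UNIV (\<lambda>_. {..sum \<eta> UNIV})"
  proof
    fix \<zeta> assume "\<zeta> \<in> particle_class \<eta>"
    then have "sum \<zeta> UNIV = sum \<eta> UNIV"
      by (simp add: particle_class_def)
    then have "\<zeta> z \<le> sum \<eta> UNIV" for z
      using member_le_sum[of z UNIV \<zeta>] by simp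
    then show "\<zeta> \<in> PiE UNIV (\<lambda>_. {..sum \<eta> UNIV})"
      by auto
  qed
qed (simp add: finite_PiE)

lemma move_in_configs:
  assumes "\<eta> \<in> configs E" and "v (\<eta> w) \<noteq> 0"
  shows "move z w \<eta> \<in> configs E"
proof -
  have "\<eta> z - 1 \<in> E"
    using assms(1) E_pred by (cases "\<eta> z") (auto simp: configs_def dest: spec[of _ z])
  then show ?thesis
    using assms E_succ by (auto simp: configs_def move_def)
qed

text \<open>A nonzero rate forces an occupied source, by \<open>u 0 = 0\<close>, so the subtraction
  does not truncate; it also forces a target with room for one more particle.\<close>

lemma move_in_particle_class:
  assumes "z \<noteq> w" and "\<zeta> \<in> particle_class \<eta>" and "u (\<zeta> z) * v (\<zeta> w) \<noteq> 0"
  shows "move z w \<zeta> \<in> particle_class \<eta>"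
proof -
  have "\<zeta> z > 0" "v (\<zeta> w) \<noteq> 0"
    using assms(3) u_0 by (auto intro!: gr0I)
  then show ?thesis
    using assms sum_move[of z w \<zeta>] move_in_configs[of \<zeta> w z]
    by (simp add: particle_class_def)
qed

text \<open>Moves that leave the class have rate zero, so the cutoff goes unnoticed. For
  \<open>f = 1\<close> this shows that the generator annihilates the indicator of the class.\<close>

lemma edge_generator_indicator_mult:
  assumes "\<zeta> \<in> particle_class \<eta>"
  shows "edge_generator u v x y (\<lambda>\<zeta>. indicator (particle_class \<eta>) \<zeta> * f \<zeta>) \<zeta> =
    edge_generator u v x y f \<zeta>"
proof -
  let ?C = "particle_class \<eta>"
  have "r * (indicator ?C \<zeta>' * f \<zeta>' - indicator ?C \<zeta> * f \<zeta>) = r * (f \<zeta>' - f \<zeta>)"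
    if "r \<noteq> 0 \<Longrightarrow> \<zeta>' \<in> ?C" for r :: real and \<zeta>'
    using that assms by (cases "r = 0") auto
  from this[OF move_in_particle_class[OF sites assms]]
    this[OF move_in_particle_class[OF sites[symmetric] assms]]
  show ?thesis
    unfolding edge_generator_def by metis
qed

lemma edge_generator_limit:
  assumes "\<eta> \<in> configs E"
  shows "((\<lambda>t. (measure_pmf.expectation (P t \<eta>) f - f \<eta>) / t)
    \<longlongrightarrow> edge_generator u v x y f \<eta>) (at_right 0)"
proof -
  let ?C = "particle_class \<eta>"
  have "\<eta> \<in> ?C"
    using assms by (simp add: particle_class_def)
  have "edge_generator u v x y (indicator ?C) \<zeta> = 0" if "\<zeta> \<in> ?C" for \<zeta>
    using edge_generator_indicator_mult[OF that, of "\<lambda>_. 1"] by (simp add: edge_generator_def)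
  then have "((\<lambda>t. (measure_pmf.expectation (P t \<eta>) f - f \<eta>) / t)
      \<longlongrightarrow> edge_generator u v x y (\<lambda>\<zeta>. indicator ?C \<zeta> * f \<zeta>) \<eta>) (at_right 0)"
    using \<open>\<eta> \<in> ?C\<close>
    by (intro generator_limit_on_invariant_class[OF transition generator finite_particle_class])
      (auto simp: particle_class_def)
  then show ?thesis
    by (simp add: edge_generator_indicator_mult[OF \<open>\<eta> \<in> ?C\<close>])
qed

text \<open>For \<open>t > 0\<close> the two difference quotients agree, since both subtract
  \<open>D \<xi> \<eta>\<close>; so their limits agree.\<close>

lemma generator_duality:
  assumes "self_dual (configs E) P D" and "\<xi> \<in> configs E" and "\<eta> \<in> configs E"
  shows "edge_generator u v x y (\<lambda>\<xi>'. D \<xi>' \<eta>) \<xi> = edge_generator u v x y (D \<xi>) \<eta>"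
proof -
  have "\<forall>\<^sub>F t in at_right (0::real). (measure_pmf.expectation (P t \<xi>) (\<lambda>\<xi>'. D \<xi>' \<eta>) - D \<xi> \<eta>) / t =
      (measure_pmf.expectation (P t \<eta>) (D \<xi>) - D \<xi> \<eta>) / t"
    using eventually_at_right_less[of "0::real"]
    by eventually_elim (use assms in \<open>simp add: self_dual_def\<close>)
  from Lim_transform_eventually[OF edge_generator_limit[OF assms(2)] this]
    edge_generator_limit[OF assms(3)]
  show ?thesis
    by (rule tendsto_unique[rotated]) simp
qed

end

section \<open>Single-particle duality and solution of the recursion\<close>

lemma factorized_single_particle:
  fixes z :: "'s::finite"
  assumes "\<And>w. d 0 (\<eta> w) = 1"
  shows "factorized d ((\<lambda>_. 0)(z := Suc 0)) \<eta> = d (Suc 0) (\<eta> z)"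
proof -
  have "factorized d ((\<lambda>_. 0)(z := Suc 0)) \<eta> = d (Suc 0) (\<eta> z) * (\<Prod>w\<in>UNIV - {z}. 1)"
    unfolding factorized_def by (subst prod.remove[of _ z]) (simp_all add: assms)
  then show ?thesis
    by simp
qed

theorem theorem2p1:
  fixes E :: "nat set" and u v :: "nat \<Rightarrow> real" and d :: "nat \<Rightarrow> nat \<Rightarrow> real"
    and x y :: "'s::finite" and P :: "real \<Rightarrow> 's config \<Rightarrow> 's config pmf"
  assumes E_v: "(E = UNIV \<and> (\<forall>n. v n > 0)) \<or>
      (\<exists>N\<ge>1. E = {0..N} \<and> v N = 0 \<and> (\<forall>n<N. v n > 0))"
    and v0: "v 0 \<noteq> 0"
    and nonneg: "\<forall>n\<in>E. u n \<ge> 0 \<and> v n \<ge> 0"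
    and u: "u 0 = 0" "u 1 = 1" "\<forall>n\<in>E. n > 0 \<longrightarrow> u n > 0"
    and sites: "x \<noteq> y"
    and process: "markov_transition_function (configs E) P"
      "has_generator (configs E) P (edge_generator u v x y)"
    and duality: "self_dual (configs E) P (factorized d)"
    and d0: "\<forall>n\<in>E. d 0 n = 1"
    and d1: "\<not> (\<exists>c. \<forall>n\<in>E. d 1 n = c)"
  shows "(\<forall>n\<in>E. u n = real n \<and> v n = v 0 + (v 1 - v 0) * real n) \<and>
    (\<exists>a b. b \<noteq> 0 \<and> (\<forall>n\<in>E. d 1 n = a + b * real n))"
proof -
  have E: "0 \<in> E" "1 \<in> E"
    using E_v by auto
  interpret edge_dynamics E u v x y P
  proof
    show "Suc n \<in> E" if "n \<in> E" "v n \<noteq> 0" for n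
      using E_v that by (auto simp: Suc_le_eq le_less)
  qed (use E_v u(1) sites process in auto)
  define g where "g = d 1"
  let ?\<delta> = "\<lambda>z. ((\<lambda>_. 0)(z := Suc 0)) :: 's config"
  have key: "v 0 * (g m - g n) =
      u n * v m * (g (n - 1) - g n) + u m * v n * (g (n + 1) - g n)"
    if "n \<in> E" "m \<in> E" for n m
  proof -
    define \<eta> :: "'s config" where "\<eta> = (\<lambda>_. 0)(x := n, y := m)"
    have \<eta>: "\<eta> \<in> configs E" "\<eta> x = n" "\<eta> y = m"
      using that E sites by (auto simp: \<eta>_def configs_def)
    have D: "factorized d (?\<delta> z) \<zeta> = g (\<zeta> z)" if "\<zeta> \<in> configs E" for z \<zeta>
      unfolding g_def One_nat_def by (rule factorized_single_particle) (use that d0 in \<open>simp add: configs_def\<close>)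
    \<comment> \<open>The lone particle can only jump from \<open>x\<close> to \<open>y\<close>, at
      rate \<open>u 1 * v 0 = v 0\<close>; the reverse rate contains \<open>u 0 = 0\<close>.\<close>
    have "edge_generator u v x y (\<lambda>\<xi>'. factorized d \<xi>' \<eta>) (?\<delta> x) = v 0 * (g m - g n)"
    proof -
      have "move x y (?\<delta> x) = ?\<delta> y"
        using sites by (auto simp: move_def)
      then show ?thesis
        using sites u \<eta> D[OF \<eta>(1)] by (simp add: edge_generator_def)
    qed
    moreover have "edge_generator u v x y (factorized d (?\<delta> x)) \<eta> =
        u n * v m * (g (n - 1) - g n) + u m * v n * (g (n + 1) - g n)"
    proof -
      have "u n * v m * factorized d (?\<delta> x) (move x y \<eta>) = u n * v m * g (n - 1)"
        using move_in_configs[OF \<eta>(1), of y x] \<eta> sites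
        by (cases "v m = 0") (simp_all add: D, simp add: move_def)
      moreover have "u m * v n * factorized d (?\<delta> x) (move y x \<eta>) = u m * v n * g (n + 1)"
        using move_in_configs[OF \<eta>(1), of x y] \<eta> sites
        by (cases "v n = 0") (simp_all add: D, simp add: move_def)
      ultimately show ?thesis
        by (simp only: edge_generator_def \<eta>(2,3) D[OF \<eta>(1)] right_diff_distrib)
    qed
    moreover have "?\<delta> x \<in> configs E"
      using E by (simp add: configs_def)
    ultimately show ?thesis
      using generator_duality[OF duality _ \<eta>(1)] by metis
  qed
  define b where "b = g 1 - g 0"
  have g: "g m = g 0 + b * u m" if "m \<in> E" for m
  proof -
    have "v 0 * (g m - g 0) = v 0 * (b * u m)"
      using key[OF E(1) that] u by (simp add: b_def mult.commute)
    then show ?thesis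
      using v0 by simp
  qed
  have "b \<noteq> 0"
    using d1 g unfolding g_def by auto
  have un: "u n = real n" if "n \<in> E" for n
    using that
  proof (induction n)
    case (Suc n)
    note g_Suc = g[OF Suc.prems] and g_n = g[OF E_pred[OF Suc.prems]]
    \<comment> \<open>For \<open>m = 0\<close> the upward term drops out by \<open>u 0 = 0\<close>.
      Inserting \<open>g\<close> as an affine function of \<open>u\<close> and cancelling
      \<open>b * u (Suc n)\<close> leaves increments of \<open>u\<close> equal to 1.\<close>
    have "v 0 * (g 0 - g (Suc n)) = v 0 * (u (Suc n) * (g n - g (Suc n)))"
      using key[OF Suc.prems E(1)] u by simp
    then have "g 0 - g (Suc n) = u (Suc n) * (g n - g (Suc n))"
      using v0 by simp
    then have "(b * u (Suc n)) * 1 = (b * u (Suc n)) * (u (Suc n) - u n)"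
      by (simp add: g_Suc g_n algebra_simps)
    moreover have "u (Suc n) \<noteq> 0"
      using u(3) Suc.prems by force
    ultimately show ?case
      using Suc \<open>b \<noteq> 0\<close> E_pred[OF Suc.prems] by simp
  qed (simp add: u)
  have vn: "v m = v 0 + (v 1 - v 0) * real m" if "m \<in> E" for m
  proof -
    \<comment> \<open>The case \<open>n = 1\<close> involves \<open>g 2\<close>, which is
      unconstrained when \<open>E = {0, 1}\<close>; there its coefficient vanishes because
      \<open>v 1 = 0\<close>.\<close>
    have "real m * v 1 * g 2 = real m * v 1 * (g 0 + b * 2)"
    proof (cases "2 \<in> E")
      case False
      then have "v 1 = 0"
        using E_succ[OF E(2)] by (auto simp: numeral_2_eq_2)
      then show ?thesis by simp
    qed (use g un in simp)
    moreover have "v 0 * (g m - g 1) = v m * (g 0 - g 1) + real m * v 1 * (g 2 - g 1)"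
      using key[OF E(2) that] u un[OF that] by (simp add: numeral_2_eq_2)
    ultimately have "b * (v 0 * (real m - 1)) = b * (real m * v 1 - v m)"
      using g[OF that] g[OF E(2)] un[OF that] u by (simp add: algebra_simps)
    then have "v 0 * (real m - 1) = real m * v 1 - v m"
      using \<open>b \<noteq> 0\<close> by simp
    then show ?thesis
      by (simp add: algebra_simps)
  qed
  show ?thesis
    using un vn g \<open>b \<noteq> 0\<close> unfolding g_def by auto
qed

end
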